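(* Let $E$ be a quadratic word equation over constants $A$ and variables $V$, and let $\mathcal{C}(E)$ be the counter system associated with $E$ (defined in the context). Then for every $\mathbf{v}\in\mathbb{N}^{V}$: $\mathbf{v}$ belongs to the length abstraction of $E$ if and only if there is $\mathbf{w}\in\mathbb{N}^V$ such that the configuration $(E,\mathbf{v})$ reaches the configuration $(\epsilon=\epsilon,\mathbf{w})$ in the transition system of $\mathcal{C}(E)$.
   Context: Let $A$ be a finite alphabet of constants and $V$ a finite set of variables, $A\cap V=\emptyset$. A word equation is $L=R$ with $L,R\in(A\cup V)^*$; it is quadratic if each variable occurs at most twice in total. A solution is a homomorphism $\sigma:(A\cup V)^*\to A^*$ fixing $A$ pointwise with $\sigma(L)=\sigma(R)$; the length abstraction of $E$ is the set of vectors $(|\sigma(x)|)_{x\in V}$ over all solutions $\sigma$. For a word $w$ and words $u$, variable $z$, $w[u/z]$ denotes $w$ with every occurrence of $z$ replaced by $u$. Nielsen transformation: for $E$ of the form $\alpha w_1=\beta w_2$ with $\alpha,\beta\in A\cup V$, $w_1,w_2\in(A\cup V)^*$, $E\Rightarrow E'$ holds in the following cases: (Erase) if $\alpha\in V$, $E'$ is $E[\epsilon/\alpha]$ (and symmetrically if $\beta\in V$, $E'$ is $E[\epsilon/\beta]$); (P1) if $\alpha=\beta$, $E'$ is $w_1=w_2$; (P2) if $\alpha\in A$, $\beta\in V$, $E'$ is $w_1[\alpha\beta/\beta]=\beta\,w_2[\alpha\beta/\beta]$; (P3) if $\alpha\in V$, $\beta\in A$, $E'$ is $\alpha\, w_1[\beta\alpha/\alpha]=w_2[\beta\alpha/\alpha]$;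 (P4) if $\alpha,\beta$ are distinct variables, either (case "$\alpha\preceq\beta$") $E'$ is $w_1[\alpha\beta/\beta]=\beta\,w_2[\alpha\beta/\beta]$, or (case "$\beta\preceq\alpha$") $E'$ is $\alpha\,w_1[\beta\alpha/\alpha]=w_2[\beta\alpha/\alpha]$. These rules keep an equation quadratic. Counter systems: a counter system is $(X,Q,\Delta)$ with a finite set of counters $X$, finite set of control states $Q$, and transitions $(q,\Phi(\bar x,\bar x'),q')$ where $\Phi$ is a Presburger formula over $X$ and primed copies $X'$. Configurations are $(q,\mathbf{v})\in Q\times\mathbb{N}^X$, and $(q,\mathbf{v})\to(q',\mathbf{v}')$ iff some transition $(q,\Phi,q')$ has $\Phi(\mathbf{v},\mathbf{v}')$ true; "reaches" means via $\to^*$. Abbreviations: $\mathrm{ID}:=\bigwedge_{x\in X}x'=x$; $\mathrm{SUB}_{y,z}:= z\le y\wedge y'=y-z\wedge\bigwedge_{x\ne y}x'=x$; $\mathrm{DEC}_y:= y>0\wedge y'=y-1\wedge\bigwedge_{x\neq y}x'=x$. $\mathcal{C}(E)$: counters $X=V$; control states all $E'$ with $E\Rightarrow^*E'$; for each step $E_1\Rightarrow E_2$ between control states a transition $(E_1,\Phi,E_2)$, where $\Phi$ is $y=0\wedge\mathrm{ID}$ if the step erases variable $y$; $\mathrm{ID}$ for (P1); $\mathrm{DEC}_\beta$ for (P2); $\mathrm{DEC}_\alpha$ for (P3); $\mathrm{SUB}_{\beta,\alpha}$ for (P4) in case $\alpha\preceq\beta$ and $\mathrm{SUB}_{\alpha,\beta}$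 in case $\beta\preceq\alpha$.
   Formalization: The Erase rule is also allowed when the opposite side is empty (otherwise x=y with lengths 0,0 gets stuck at ε=y or x=ε), and the alphabet A is assumed nonempty (otherwise ε=ε with |x|=1 is a counterexample). *)

theory Defs
  imports Main "HOL-Library.FuncSet"
begin

section \<open>Word equations\<close>

datatype ('a, 'v) sym = Con 'a | Var 'v

type_synonym ('a, 'v) weq = "('a, 'v) sym list \<times> ('a, 'v) sym list"

definition words :: "'a set \<Rightarrow> 'v set \<Rightarrow> ('a, 'v) sym list set" where
  "words A V = lists (Con ` A \<union> Var ` V)"

definition word_equation :: "'a set \<Rightarrow> 'v set \<Rightarrow> ('a, 'v) weq \<Rightarrow> bool" where
  "word_equation A V E \<longleftrightarrow> fst E \<in> words A V \<and> snd E \<in> words A V"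

definition quadratic :: "('a, 'v) weq \<Rightarrow> bool" where
  "quadratic E \<longleftrightarrow> (\<forall>x. count_list (fst E @ snd E) (Var x) \<le> 2)"

definition solution ::
  "'a set \<Rightarrow> 'v set \<Rightarrow> ('a, 'v) weq \<Rightarrow> (('a, 'v) sym list \<Rightarrow> 'a list) \<Rightarrow> bool" where
  "solution A V E \<sigma> \<longleftrightarrow>
     \<sigma> \<in> words A V \<rightarrow> lists A \<and>
     \<sigma> [] = [] \<and>
     (\<forall>u\<in>words A V. \<forall>w\<in>words A V. \<sigma> (u @ w) = \<sigma> u @ \<sigma> w) \<and>
     (\<forall>a\<in>A. \<sigma> [Con a] = [a]) \<and>
     \<sigma> (fst E) = \<sigma> (snd E)"

text \<open>Vectors indexed by a set \<open>X\<close> are the extensional functions in \<^term>\<open>X \<rightarrow>\<^sub>E (UNIV :: nat set)\<close>.\<close>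

definition length_abstraction :: "'a set \<Rightarrow> 'v set \<Rightarrow> ('a, 'v) weq \<Rightarrow> ('v \<Rightarrow> nat) set" where
  "length_abstraction A V E = {\<lambda>x\<in>V. length (\<sigma> [Var x]) | \<sigma>. solution A V E \<sigma>}"

definition subst :: "('a, 'v) sym list \<Rightarrow> 'v \<Rightarrow> ('a, 'v) sym list \<Rightarrow> ('a, 'v) sym list" where
  "subst u z w = concat (map (\<lambda>s. if s = Var z then u else [s]) w)"


section \<open>Nielsen transformation\<close>

text \<open>Steps carry a label, since the transition formula depends on the rule that is applied and
  not only on the two equations.  \<open>P4_le x y\<close> is the case in which \<open>\<alpha> = x\<close>, \<open>\<beta> = y\<close> and
  \<open>\<alpha> \<preceq> \<beta>\<close>; \<open>P4_ge x y\<close> is the case \<open>\<beta> \<preceq> \<alpha>\<close>.\<close>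

datatype 'v nielsen_rule = Erase 'v | P1 | P2 'v | P3 'v | P4_le 'v 'v | P4_ge 'v 'v

text \<open>Only the erased variable has to be at the front of its side; the other side may be empty.
  Otherwise an equation such as \<open>x = \<epsilon>\<close> would have no successor, although it is solvable.\<close>

inductive nielsen ::
  "('a, 'v) weq \<Rightarrow> 'v nielsen_rule \<Rightarrow> ('a, 'v) weq \<Rightarrow> bool" where
  Erase_left: "nielsen (Var x # w1, R) (Erase x) (subst [] x (Var x # w1), subst [] x R)"
| Erase_right: "nielsen (L, Var y # w2) (Erase y) (subst [] y L, subst [] y (Var y # w2))"
| P1: "nielsen (\<alpha> # w1, \<alpha> # w2) P1 (w1, w2)"
| P2: "nielsen (Con a # w1, Var y # w2) (P2 y)
         (subst [Con a, Var y] y w1, Var y # subst [Con a, Var y] y w2)"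
| P3: "nielsen (Var x # w1, Con b # w2) (P3 x)
         (Var x # subst [Con b, Var x] x w1, subst [Con b, Var x] x w2)"
| P4_le: "x \<noteq> y \<Longrightarrow> nielsen (Var x # w1, Var y # w2) (P4_le x y)
         (subst [Var x, Var y] y w1, Var y # subst [Var x, Var y] y w2)"
| P4_ge: "x \<noteq> y \<Longrightarrow> nielsen (Var x # w1, Var y # w2) (P4_ge x y)
         (Var x # subst [Var y, Var x] x w1, subst [Var y, Var x] x w2)"

definition nielsen_step :: "('a, 'v) weq \<Rightarrow> ('a, 'v) weq \<Rightarrow> bool" where
  "nielsen_step E E' \<longleftrightarrow> (\<exists>r. nielsen E r E')"


section \<open>Presburger formulas and counter systems\<close>

text \<open>\<open>Cur x\<close> is the counter \<open>x\<close> and \<open>Next x\<close> its primed copy.  All variables, including the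
  quantified ones \<open>Bound n\<close>, range over the natural numbers; terms take integer values, so that
  subtraction is not truncated.\<close>

datatype 'x pvar = Cur 'x | Next 'x | Bound nat

datatype 'x pterm =
  TConst int
| TVar "'x pvar"
| TAdd "'x pterm" "'x pterm"
| TSub "'x pterm" "'x pterm"

datatype 'x pformula =
  FTrue
| FEq "'x pterm" "'x pterm"
| FLe "'x pterm" "'x pterm"
| FLess "'x pterm" "'x pterm"
| FNot "'x pformula"
| FAnd "'x pformula" "'x pformula"
| FEx nat "'x pformula"

primrec tval :: "('x pvar \<Rightarrow> nat) \<Rightarrow> 'x pterm \<Rightarrow> int" where
  "tval e (TConst c) = c"
| "tval e (TVar p) = int (e p)"
| "tval e (TAdd s t) = tval e s + tval e t"
| "tval e (TSub s t) = tval e s - tval e t"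

primrec fval :: "('x pvar \<Rightarrow> nat) \<Rightarrow> 'x pformula \<Rightarrow> bool" where
  "fval e FTrue = True"
| "fval e (FEq s t) = (tval e s = tval e t)"
| "fval e (FLe s t) = (tval e s \<le> tval e t)"
| "fval e (FLess s t) = (tval e s < tval e t)"
| "fval e (FNot \<phi>) = (\<not> fval e \<phi>)"
| "fval e (FAnd \<phi> \<psi>) = (fval e \<phi> \<and> fval e \<psi>)"
| "fval e (FEx n \<phi>) = (\<exists>k. fval (e(Bound n := k)) \<phi>)"

primrec tvars :: "'x pterm \<Rightarrow> 'x pvar set" where
  "tvars (TConst c) = {}"
| "tvars (TVar p) = {p}"
| "tvars (TAdd s t) = tvars s \<union> tvars t"
| "tvars (TSub s t) = tvars s \<union> tvars t"

primrec fvars :: "'x pformula \<Rightarrow> 'x pvar set" where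
  "fvars FTrue = {}"
| "fvars (FEq s t) = tvars s \<union> tvars t"
| "fvars (FLe s t) = tvars s \<union> tvars t"
| "fvars (FLess s t) = tvars s \<union> tvars t"
| "fvars (FNot \<phi>) = fvars \<phi>"
| "fvars (FAnd \<phi> \<psi>) = fvars \<phi> \<union> fvars \<psi>"
| "fvars (FEx n \<phi>) = fvars \<phi> - {Bound n}"

definition holds :: "'x pformula \<Rightarrow> ('x \<Rightarrow> nat) \<Rightarrow> ('x \<Rightarrow> nat) \<Rightarrow> bool" where
  "holds \<Phi> v v' \<longleftrightarrow>
     fval (\<lambda>p. case p of Cur x \<Rightarrow> v x | Next x \<Rightarrow> v' x | Bound n \<Rightarrow> 0) \<Phi>"

record ('x, 'q) counter_system =
  counters :: "'x set"
  control :: "'q set"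
  transitions :: "('q \<times> 'x pformula \<times> 'q) set"

definition is_counter_system :: "('x, 'q) counter_system \<Rightarrow> bool" where
  "is_counter_system C \<longleftrightarrow>
     finite (counters C) \<and> finite (control C) \<and>
     (\<forall>(q, \<Phi>, q') \<in> transitions C.
        q \<in> control C \<and> q' \<in> control C \<and>
        fvars \<Phi> \<subseteq> Cur ` counters C \<union> Next ` counters C)"

definition configurations :: "('x, 'q) counter_system \<Rightarrow> ('q \<times> ('x \<Rightarrow> nat)) set" where
  "configurations C = control C \<times> (counters C \<rightarrow>\<^sub>E UNIV)"

definition cs_step ::
  "('x, 'q) counter_system \<Rightarrow> 'q \<times> ('x \<Rightarrow> nat) \<Rightarrow> 'q \<times> ('x \<Rightarrow> nat) \<Rightarrow> bool" where
  "cs_step C c c' \<longleftrightarrow>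
     c \<in> configurations C \<and> c' \<in> configurations C \<and>
     (\<exists>\<Phi>. (fst c, \<Phi>, fst c') \<in> transitions C \<and> holds \<Phi> (snd c) (snd c'))"

definition cs_reaches ::
  "('x, 'q) counter_system \<Rightarrow> 'q \<times> ('x \<Rightarrow> nat) \<Rightarrow> 'q \<times> ('x \<Rightarrow> nat) \<Rightarrow> bool" where
  "cs_reaches C = (cs_step C)\<^sup>*\<^sup>*"


section \<open>The counter system of a word equation\<close>

text \<open>The order of the conjuncts is irrelevant, so an arbitrary enumeration of the finite set is
  used.\<close>

definition FConj :: "'i set \<Rightarrow> ('i \<Rightarrow> 'x pformula) \<Rightarrow> 'x pformula" where
  "FConj I \<phi> = foldr (\<lambda>i. FAnd (\<phi> i)) (SOME is. distinct is \<and> set is = I) FTrue"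

definition ID_form :: "'x set \<Rightarrow> 'x pformula" where
  "ID_form X = FConj X (\<lambda>x. FEq (TVar (Next x)) (TVar (Cur x)))"

definition SUB_form :: "'x set \<Rightarrow> 'x \<Rightarrow> 'x \<Rightarrow> 'x pformula" where
  "SUB_form X y z =
     FAnd (FLe (TVar (Cur z)) (TVar (Cur y)))
       (FAnd (FEq (TVar (Next y)) (TSub (TVar (Cur y)) (TVar (Cur z))))
         (FConj (X - {y}) (\<lambda>x. FEq (TVar (Next x)) (TVar (Cur x)))))"

definition DEC_form :: "'x set \<Rightarrow> 'x \<Rightarrow> 'x pformula" where
  "DEC_form X y =
     FAnd (FLess (TConst 0) (TVar (Cur y)))
       (FAnd (FEq (TVar (Next y)) (TSub (TVar (Cur y)) (TConst 1)))
         (FConj (X - {y}) (\<lambda>x. FEq (TVar (Next x)) (TVar (Cur x)))))"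

primrec rule_formula :: "'v set \<Rightarrow> 'v nielsen_rule \<Rightarrow> 'v pformula" where
  "rule_formula V (Erase y) = FAnd (FEq (TVar (Cur y)) (TConst 0)) (ID_form V)"
| "rule_formula V P1 = ID_form V"
| "rule_formula V (P2 y) = DEC_form V y"
| "rule_formula V (P3 x) = DEC_form V x"
| "rule_formula V (P4_le x y) = SUB_form V y x"
| "rule_formula V (P4_ge x y) = SUB_form V x y"

definition weq_counter_system ::
  "'v set \<Rightarrow> ('a, 'v) weq \<Rightarrow> ('v, ('a, 'v) weq) counter_system" where
  "weq_counter_system V E =
     \<lparr>counters = V,
      control = {E'. nielsen_step\<^sup>*\<^sup>* E E'},
      transitions = {(E1, rule_formula V r, E2) | E1 r E2.
                       nielsen_step\<^sup>*\<^sup>* E E1 \<and> nielsen_step\<^sup>*\<^sup>* E E2 \<and> nielsen E1 r E2}\<rparr>"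


section \<open>Well-definedness of the counter system\<close>

lemma enum_SOME:
  assumes "finite I"
  shows "distinct (SOME is. distinct is \<and> set is = I) \<and> set (SOME is. distinct is \<and> set is = I) = I"
  using finite_distinct_list[OF assms] by (metis (mono_tags, lifting) someI_ex)

lemma fval_FConj:
  assumes "finite I"
  shows "fval e (FConj I \<phi>) \<longleftrightarrow> (\<forall>i\<in>I. fval e (\<phi> i))"
proof -
  have "fval e (foldr (\<lambda>i. FAnd (\<phi> i)) is FTrue) \<longleftrightarrow> (\<forall>i\<in>set is. fval e (\<phi> i))" for "is"
    by (induction "is") auto
  then show ?thesis
    using enum_SOME[OF assms] by (simp add: FConj_def)
qed

lemma fvars_FConj:
  assumes "finite I"
  shows "fvars (FConj I \<phi>) = (\<Union>i\<in>I. fvars (\<phi> i))"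
proof -
  have "fvars (foldr (\<lambda>i. FAnd (\<phi> i)) is FTrue) = (\<Union>i\<in>set is. fvars (\<phi> i))" for "is"
    by (induction "is") auto
  then show ?thesis
    using enum_SOME[OF assms] by (simp add: FConj_def)
qed

lemma holds_ID_form:
  assumes "finite X"
  shows "holds (ID_form X) v v' \<longleftrightarrow> (\<forall>x\<in>X. v' x = v x)"
  by (simp add: holds_def ID_form_def fval_FConj assms)

lemma holds_SUB_form:
  assumes "finite X"
  shows "holds (SUB_form X y z) v v' \<longleftrightarrow> v z \<le> v y \<and> v' y = v y - v z \<and> (\<forall>x\<in>X - {y}. v' x = v x)"
  by (auto simp: holds_def SUB_form_def fval_FConj assms)

lemma holds_DEC_form:
  assumes "finite X"
  shows "holds (DEC_form X y) v v' \<longleftrightarrow> v y > 0 \<and> v' y = v y - 1 \<and> (\<forall>x\<in>X - {y}. v' x = v x)"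
  by (auto simp: holds_def DEC_form_def fval_FConj assms)

lemma subst_simps [simp]:
  "subst u z [] = []"
  "subst u z (s # w) = (if s = Var z then u else [s]) @ subst u z w"
  "subst u z (w @ w') = subst u z w @ subst u z w'"
  by (simp_all add: subst_def)

lemma count_list_subst:
  "count_list (subst u z w) s =
     (if s = Var z then 0 else count_list w s) + count_list w (Var z) * count_list u s"
  by (induction w) auto

lemma length_subst:
  "length (subst u z w) + count_list w (Var z) = length w + count_list w (Var z) * length u"
  by (induction w) auto

lemma set_subst: "set (subst u z w) \<subseteq> set w \<union> set u"
  by (induction w) auto

lemma word_equation_iff:
  "word_equation A V E \<longleftrightarrow> set (fst E) \<union> set (snd E) \<subseteq> Con ` A \<union> Var ` V"
  unfolding word_equation_def words_def by (auto simp only: in_lists_conv_set)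

lemma nielsen_word_equation:
  assumes "nielsen E r E'" "word_equation A V E"
  shows "word_equation A V E'"
proof -
  have "set (fst E') \<union> set (snd E') \<subseteq> set (fst E) \<union> set (snd E)"
    using assms(1) by cases (use set_subst in \<open>fastforce+\<close>)
  then show ?thesis
    using assms(2) unfolding word_equation_iff by blast
qed

lemma nielsen_quadratic:
  assumes "nielsen E r E'" "quadratic E"
  shows "quadratic E'"
proof -
  have q: "count_list (fst E) (Var x) + count_list (snd E) (Var x) \<le> 2" for x
    using assms(2) by (simp add: quadratic_def)
  have "count_list (fst E') (Var z) + count_list (snd E') (Var z) \<le> 2" for z
    using assms(1)
  proof cases
    case (P4_le x y w1 w2)
    then show ?thesis
      using q[of x] q[of y] q[of z] by (auto simp: count_list_subst split: if_splits)
  next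
    case (P4_ge x y w1 w2)
    then show ?thesis
      using q[of x] q[of y] q[of z] by (auto simp: count_list_subst split: if_splits)
  qed (use q[of z] in \<open>auto simp: count_list_subst split: if_splits\<close>)
  then show ?thesis
    by (simp add: quadratic_def)
qed

lemma nielsen_length:
  assumes "nielsen E r E'" "quadratic E"
  shows "length (fst E') + length (snd E') \<le> length (fst E) + length (snd E)"
proof -
  have q: "count_list (fst E) (Var x) + count_list (snd E) (Var x) \<le> 2" for x
    using assms(2) by (simp add: quadratic_def)
  have l0: "length (subst [] z w) \<le> length w" for z and w :: "('a, 'b) sym list"
    using length_subst[of "[]" z w] by simp
  have l2: "length (subst [s, t] z w) = length w + count_list w (Var z)"
    for s t z and w :: "('a, 'b) sym list"
    using length_subst[of "[s, t]" z w] by simp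
  show ?thesis
    using assms(1)
  proof cases
    case (Erase_left x w1 R)
    then show ?thesis using l0[of x w1] l0[of x R] by simp
  next
    case (Erase_right L y w2)
    then show ?thesis using l0[of y w2] l0[of y L] by simp
  next
    case (P2 a w1 y w2)
    then show ?thesis using q[of y] by (simp add: l2)
  next
    case (P3 x w1 b w2)
    then show ?thesis using q[of x] by (simp add: l2)
  next
    case (P4_le x y w1 w2)
    then show ?thesis using q[of y] by (simp add: l2)
  next
    case (P4_ge x y w1 w2)
    then show ?thesis using q[of x] by (simp add: l2)
  qed simp
qed

lemma nielsen_rule_formula_vars:
  assumes "nielsen E r E'" "word_equation A V E" "finite V"
  shows "fvars (rule_formula V r) \<subseteq> Cur ` V \<union> Next ` V"
  using assms
  by cases (auto simp: word_equation_iff ID_form_def SUB_form_def DEC_form_def fvars_FConj)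

lemma is_counter_system_weq_counter_system:
  assumes "finite A" "finite V" "word_equation A V E" "quadratic E"
  shows "is_counter_system (weq_counter_system V E)"
proof -
  define N where "N = length (fst E) + length (snd E)"
  define W where "W = {w. set w \<subseteq> Con ` A \<union> Var ` V \<and> length w \<le> N}"
  have inv: "word_equation A V E' \<and> quadratic E' \<and> length (fst E') + length (snd E') \<le> N"
    if "nielsen_step\<^sup>*\<^sup>* E E'" for E'
    using that
  proof (induction rule: rtranclp_induct)
    case base
    then show ?case using assms by (simp add: N_def)
  next
    case (step E1 E2)
    then obtain r where r: "nielsen E1 r E2"
      by (auto simp: nielsen_step_def)
    show ?case
      using nielsen_word_equation[OF r] nielsen_quadratic[OF r] nielsen_length[OF r] step.IH
      by fastforce
  qed
  have "finite W"
    unfolding W_def using assms by (intro finite_lists_length_le) auto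
  moreover have "{E'. nielsen_step\<^sup>*\<^sup>* E E'} \<subseteq> W \<times> W"
    using inv by (fastforce simp: W_def word_equation_iff)
  ultimately have "finite {E'. nielsen_step\<^sup>*\<^sup>* E E'}"
    by (meson finite_SigmaI finite_subset)
  then show ?thesis
    using assms(2) inv nielsen_rule_formula_vars
    unfolding is_counter_system_def weq_counter_system_def by fastforce
qed

end

theory Submission
  imports Defs
begin

text \<open>A solution is determined by the words assigned to the variables. Each Nielsen step replaces a
  solution of an equation by a solution of its successor, and the transition formula of the step
  records exactly the change of lengths; conversely every solution of the successor whose lengths
  satisfy the formula lifts back, because the prefix cut off by the step is prescribed by the head
  of the other side. A solution can always be followed: if neither head is mapped to the empty
  word, the image of one head is a prefix of the image of the other. The process stops since each
  step decreases either the total length of the solution or, keeping it, the size of the equation.\<close>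

section \<open>Solutions as assignments of words to variables\<close>

primrec hom_ext :: "('v \<Rightarrow> 'a list) \<Rightarrow> ('a, 'v) sym list \<Rightarrow> 'a list" where
  "hom_ext h [] = []"
| "hom_ext h (s # w) = (case s of Con a \<Rightarrow> [a] | Var x \<Rightarrow> h x) @ hom_ext h w"

lemma hom_ext_append [simp]: "hom_ext h (u @ w) = hom_ext h u @ hom_ext h w"
  by (induction u) auto

text \<open>Trades a substitution in the equation for an update of the assignment, so that a Nielsen
  step becomes a change of a single value.\<close>

lemma hom_ext_subst: "hom_ext h (subst u z w) = hom_ext (h(z := hom_ext h u)) w"
  by (induction w) (auto split: sym.split)

lemma hom_ext_in_lists:
  assumes "w \<in> words A V" "\<forall>x\<in>V. h x \<in> lists A"
  shows "hom_ext h w \<in> lists A"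
  using assms by (induction w) (auto simp: words_def)

definition solves :: "'a set \<Rightarrow> 'v set \<Rightarrow> ('a, 'v) weq \<Rightarrow> ('v \<Rightarrow> 'a list) \<Rightarrow> bool" where
  "solves A V E h \<longleftrightarrow> (\<forall>x\<in>V. h x \<in> lists A) \<and> hom_ext h (fst E) = hom_ext h (snd E)"

definition length_vector :: "'v set \<Rightarrow> ('v \<Rightarrow> 'a list) \<Rightarrow> 'v \<Rightarrow> nat" where
  "length_vector V h = (\<lambda>x\<in>V. length (h x))"

lemma length_vector_apply [simp]: "x \<in> V \<Longrightarrow> length_vector V h x = length (h x)"
  by (simp add: length_vector_def)

lemma length_vector_extensional [simp]: "length_vector V h \<in> V \<rightarrow>\<^sub>E UNIV"
  by (simp add: length_vector_def)

lemma eq_length_vectorI: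
  assumes "v \<in> V \<rightarrow>\<^sub>E UNIV" "\<And>x. x \<in> V \<Longrightarrow> v x = length (h x)"
  shows "v = length_vector V h"
  using assms by (intro extensionalityI[of _ V]) (auto simp: length_vector_def PiE_def)

text \<open>A homomorphism is fixed by its values on single symbols. \<open>solution\<close>
  constrains \<sigma> only on words over \<open>A\<close> and \<open>V\<close>; peeling off the
  first symbol stays within them.\<close>

lemma solution_hom_ext:
  assumes "solution A V E \<sigma>" "w \<in> words A V"
  shows "\<sigma> w = hom_ext (\<lambda>x. \<sigma> [Var x]) w"
  using assms(2)
proof (induction w)
  case Nil
  then show ?case using assms(1) by (simp add: solution_def)
next
  case (Cons s w)
  then have "[s] \<in> words A V" "w \<in> words A V"
    by (auto simp: words_def)
  then have "\<sigma> (s # w) = \<sigma> [s] @ \<sigma> w"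
    using assms(1) unfolding solution_def by (metis append_Cons append_Nil)
  then show ?case
    using Cons assms(1) by (auto simp: words_def solution_def split: sym.split)
qed

lemma length_abstraction_eq:
  assumes "word_equation A V E"
  shows "length_abstraction A V E = {length_vector V h | h. solves A V E h}"
proof (intro set_eqI iffI)
  fix v assume "v \<in> length_abstraction A V E"
  then obtain \<sigma> where \<sigma>: "solution A V E \<sigma>" "v = (\<lambda>x\<in>V. length (\<sigma> [Var x]))"
    by (auto simp: length_abstraction_def)
  have "\<sigma> [Var x] \<in> lists A" if "x \<in> V" for x
  proof -
    have "[Var x] \<in> words A V" using that by (simp add: words_def)
    then show ?thesis using \<sigma>(1) unfolding solution_def by blast
  qed
  moreover have "hom_ext (\<lambda>x. \<sigma> [Var x]) (fst E) = hom_ext (\<lambda>x. \<sigma> [Var x]) (snd E)"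
    using solution_hom_ext[OF \<sigma>(1), of "fst E"] solution_hom_ext[OF \<sigma>(1), of "snd E"] assms \<sigma>(1)
    by (simp add: solution_def word_equation_def)
  ultimately show "v \<in> {length_vector V h | h. solves A V E h}"
    using \<sigma>(2) unfolding solves_def length_vector_def
    by (intro CollectI exI[of _ "\<lambda>x. \<sigma> [Var x]"]) simp
next
  fix v assume "v \<in> {length_vector V h | h. solves A V E h}"
  then obtain h where h: "solves A V E h" "v = length_vector V h"
    by blast
  then have "solution A V E (hom_ext h)"
    using hom_ext_in_lists[of _ A V h] unfolding solution_def solves_def by simp
  then show "v \<in> length_abstraction A V E"
    using h(2) unfolding length_abstraction_def length_vector_def
    by (intro CollectI exI[of _ "hom_ext h"]) simp
qed

section \<open>Lifting a solution back along a step\<close>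

lemma hom_ext_erase:
  assumes "h x = []"
  shows "hom_ext h (subst [] x w) = hom_ext h w"
  using assms by (simp add: hom_ext_subst fun_upd_idem)

text \<open>As \<open>s\<close> is not \<open>Var y\<close>, \<open>h\<close> and \<open>h'\<close>
  agree on \<open>s\<close>, so substituting \<open>[s, Var y]\<close> undoes the cut: under
  \<open>h'\<close> the new tails have the values of the old tails under \<open>h\<close>. What
  remains is to cancel the common prefix \<open>hom_ext h [s]\<close>.\<close>

lemma hom_ext_cut:
  assumes "s \<noteq> Var y" "h' = h(y := u)" "h y = hom_ext h [s] @ u"
  shows "hom_ext h (s # w1) = hom_ext h (Var y # w2) \<longleftrightarrow>
    hom_ext h' (subst [s, Var y] y w1) = hom_ext h' (Var y # subst [s, Var y] y w2)"
proof -
  have "h'(y := hom_ext h' [s, Var y]) = h"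
    using assms by (auto split: sym.splits)
  then have "hom_ext h' (subst [s, Var y] y w) = hom_ext h w" for w
    by (simp add: hom_ext_subst)
  then show ?thesis
    using assms by simp
qed

text \<open>The guards \<open>v y > 0\<close> and \<open>v z \<le> v y\<close> make the truncated
  subtraction invertible: the old length is the new one plus that of the opposite head, which is the
  word to put back.\<close>

lemma solves_pull_back:
  assumes "nielsen E r E'" "word_equation A V E" "finite V" "v \<in> V \<rightarrow>\<^sub>E UNIV"
    and "solves A V E' h'" "holds (rule_formula V r) v (length_vector V h')"
  shows "\<exists>h. solves A V E h \<and> v = length_vector V h"
proof -
  \<comment> \<open>P2, P3 and both cases of P4 at once: \<open>y\<close> is the variable that was
    shortened, \<open>s\<close> the head opposite to it, and the disjunction covers the two
    orientations.\<close>
  have lift: ?thesis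
    if "s \<noteq> Var y" "y \<in> V" "[s] \<in> words A V"
      and E: "E = (s # w1, Var y # w2) \<and>
          E' = (subst [s, Var y] y w1, Var y # subst [s, Var y] y w2) \<or>
        E = (Var y # w2, s # w1) \<and>
          E' = (Var y # subst [s, Var y] y w2, subst [s, Var y] y w1)"
      and len: "v y = length (hom_ext h' [s]) + length (h' y)"
        "\<forall>x\<in>V - {y}. v x = length (h' x)" for s y w1 w2
  proof -
    define h where "h = h'(y := hom_ext h' [s] @ h' y)"
    have "hom_ext h (s # w1) = hom_ext h (Var y # w2) \<longleftrightarrow>
        hom_ext h' (subst [s, Var y] y w1) = hom_ext h' (Var y # subst [s, Var y] y w2)"
      by (rule hom_ext_cut[where u = "h' y"])
        (use that(1) in \<open>auto simp: h_def split: sym.split\<close>)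
    moreover have "hom_ext h' [s] \<in> lists A"
      using hom_ext_in_lists[OF that(3)] assms(5) unfolding solves_def by blast
    ultimately have "solves A V E h"
      using assms(5) E that(2) by (auto simp: solves_def h_def)
    moreover have "v = length_vector V h"
      using assms(4) len by (intro eq_length_vectorI) (auto simp: h_def)
    ultimately show ?thesis by blast
  qed
  \<comment> \<open>For erasure and P1 the same assignment serves both equations.\<close>
  have keep: ?thesis if "solves A V E h'" "\<forall>x\<in>V. length_vector V h' x = v x"
    using that assms(4) eq_length_vectorI[of v V h'] by auto
  show ?thesis
    using assms(1)
  proof cases
    case (Erase_left x w1 R)
    then have "x \<in> V" using assms(2) by (auto simp: word_equation_iff)
    moreover have eq: "v x = 0" "\<forall>z\<in>V. length_vector V h' z = v z"
      using assms(3,6) Erase_left by (auto simp: holds_def holds_ID_form[unfolded holds_def])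
    ultimately have "h' x = []" by auto
    then show ?thesis
      using keep eq(2) assms(5) Erase_left by (simp add: solves_def hom_ext_erase)
  next
    case (Erase_right L y w2)
    then have "y \<in> V" using assms(2) by (auto simp: word_equation_iff)
    moreover have eq: "v y = 0" "\<forall>z\<in>V. length_vector V h' z = v z"
      using assms(3,6) Erase_right by (auto simp: holds_def holds_ID_form[unfolded holds_def])
    ultimately have "h' y = []" by auto
    then show ?thesis
      using keep eq(2) assms(5) Erase_right by (simp add: solves_def hom_ext_erase)
  next
    case (P1 \<alpha> w1 w2)
    then show ?thesis
      using keep assms(3,5,6) by (simp add: solves_def holds_ID_form)
  next
    case (P2 a w1 y w2)
    then have "y \<in> V" "[Con a] \<in> words A V"
      using assms(2) by (auto simp: word_equation_iff words_def)
    then show ?thesis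
      using assms(3,6) P2 by (intro lift[of "Con a" y w1 w2]) (auto simp: holds_DEC_form)
  next
    case (P3 x w1 b w2)
    then have "x \<in> V" "[Con b] \<in> words A V"
      using assms(2) by (auto simp: word_equation_iff words_def)
    then show ?thesis
      using assms(3,6) P3 by (intro lift[of "Con b" x w2 w1]) (auto simp: holds_DEC_form)
  next
    case (P4_le x y w1 w2)
    then have "x \<in> V" "y \<in> V" "[Var x] \<in> words A V"
      using assms(2) by (auto simp: word_equation_iff words_def)
    then show ?thesis
      using assms(3,6) P4_le by (intro lift[of "Var x" y w1 w2]) (auto simp: holds_SUB_form)
  next
    case (P4_ge x y w1 w2)
    then have "x \<in> V" "y \<in> V" "[Var y] \<in> words A V"
      using assms(2) by (auto simp: word_equation_iff words_def)
    then show ?thesis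
      using assms(3,6) P4_ge by (intro lift[of "Var y" x w2 w1]) (auto simp: holds_SUB_form)
  qed
qed

section \<open>Following a solution forward, with a measure for termination\<close>

definition solution_rank :: "'v set \<Rightarrow> (('a, 'v) weq \<times> ('v \<Rightarrow> 'a list)) rel" where
  "solution_rank V = measures
     [\<lambda>(E, h). \<Sum>x\<in>V. length (h x), \<lambda>(E, h). length (fst E) + length (snd E)]"

lemma wf_solution_rank: "wf (solution_rank V)"
  by (simp add: solution_rank_def)

text \<open>The total solution length is compared first, so its strict drop decides whatever the
  size of \<open>E'\<close>.\<close>

lemma solution_rank_cut:
  assumes "finite V" "y \<in> V" "h y = p @ u" "p \<noteq> []"
  shows "((E', h(y := u)), (E, h)) \<in> solution_rank V"
proof -
  have "(\<Sum>x\<in>V. length ((h(y := u)) x)) < (\<Sum>x\<in>V. length (h x))"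
    using assms by (intro sum_strict_mono_ex1) auto
  then show ?thesis by (simp add: solution_rank_def)
qed

text \<open>For erasure and P1: with the assignment unchanged the first component ties and the size
  of the equation decides.\<close>

lemma solution_rank_shrink:
  assumes "length (fst E') + length (snd E') < length (fst E) + length (snd E)"
  shows "((E', h), (E, h)) \<in> solution_rank V"
  using assms by (simp add: solution_rank_def)

lemma length_subst_Nil_le: "length (subst [] z w) \<le> length w"
  using length_subst[of "[]" z w] by simp

text \<open>Heads with empty image are erased first, so every prefix that gets cut off is nonempty
  and the rank really drops.\<close>

lemma solves_push_forward:
  assumes "solves A V E h" "word_equation A V E" "finite V" "E \<noteq> ([], [])"
  shows "\<exists>r E' h'. nielsen E r E' \<and> solves A V E' h' \<and>
    holds (rule_formula V r) (length_vector V h) (length_vector V h') \<and>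
    ((E', h'), (E, h)) \<in> solution_rank V"
    (is "\<exists>r E' h'. ?step r E' h'")
proof -
  obtain L R where E: "E = (L, R)" by (cases E)
  have eq: "hom_ext h L = hom_ext h R" and h: "\<forall>x\<in>V. h x \<in> lists A"
    using assms(1) E by (auto simp: solves_def)
  have ID: "holds (ID_form V) (length_vector V h) (length_vector V h)"
    using assms(3) by (simp add: holds_ID_form)
  have erase_left: ?thesis if "L = Var x # w1" "h x = []" for x w1
  proof -
    have "x \<in> V" using assms(2) that E by (auto simp: word_equation_iff)
    then have "?step (Erase x) (subst [] x (Var x # w1), subst [] x R) h"
      using nielsen.Erase_left[of x w1 R] ID that E eq h
        length_subst_Nil_le[of x w1] length_subst_Nil_le[of x R]
      by (auto simp: solves_def hom_ext_erase holds_def intro!: solution_rank_shrink)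
    then show ?thesis by blast
  qed
  have erase_right: ?thesis if "R = Var y # w2" "h y = []" for y w2
  proof -
    have "y \<in> V" using assms(2) that E by (auto simp: word_equation_iff)
    then have "?step (Erase y) (subst [] y L, subst [] y (Var y # w2)) h"
      using nielsen.Erase_right[of L y w2] ID that E eq h
        length_subst_Nil_le[of y w2] length_subst_Nil_le[of y L]
      by (auto simp: solves_def hom_ext_erase holds_def intro!: solution_rank_shrink)
    then show ?thesis by blast
  qed
  have pop: ?thesis if "L = s # w1" "R = s # w2" for s w1 w2
  proof -
    have "?step P1 (w1, w2) h"
      using nielsen.P1[of s w1 w2] ID that E eq h
      by (auto simp: solves_def intro!: solution_rank_shrink)
    then show ?thesis by blast
  qed
  \<comment> \<open>The last premise asks for the transition formula for every \<open>h'\<close>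
    that differs from \<open>h\<close> only at \<open>y\<close> and has the right length there; this
    lets one argument serve DEC and SUB alike.\<close>
  have cut: ?thesis
    if "s \<noteq> Var y" "h y = hom_ext h [s] @ u" "hom_ext h [s] \<noteq> []"
      and E': "E = (s # w1, Var y # w2) \<and>
          E' = (subst [s, Var y] y w1, Var y # subst [s, Var y] y w2) \<or>
        E = (Var y # w2, s # w1) \<and>
          E' = (Var y # subst [s, Var y] y w2, subst [s, Var y] y w1)"
      and r: "nielsen E r E'"
        "\<And>h'. \<lbrakk>length (h y) = length (hom_ext h [s]) + length (h' y);
            \<forall>x. x \<noteq> y \<longrightarrow> h' x = h x\<rbrakk>
          \<Longrightarrow> holds (rule_formula V r) (length_vector V h) (length_vector V h')"
    for s y u w1 w2 E' r
  proof -
    have y: "y \<in> V" using assms(2) E' by (auto simp: word_equation_iff)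
    moreover have "u \<in> lists A" using bspec[OF h y] that(2) by simp
    ultimately have "solves A V E' (h(y := u))"
      using hom_ext_cut[OF that(1) refl that(2), of w1 w2] E' assms(1)
      by (auto simp del: hom_ext.simps simp: solves_def)
    moreover have "((E', h(y := u)), (E, h)) \<in> solution_rank V"
      using solution_rank_cut[of V y h] assms(3) y that(2,3) by blast
    moreover have "holds (rule_formula V r) (length_vector V h) (length_vector V (h(y := u)))"
      using that(2) by (intro r(2)) auto
    ultimately show ?thesis
      using r(1) by blast
  qed
  \<comment> \<open>If one side is empty, a variable heading the other has empty image and can be
    erased, while a constant there contradicts the equation.\<close>
  consider "L = []" "R = []" | y w2 where "L = []" "R = Var y # w2"
    | x w1 where "L = Var x # w1" "R = []" | a w where "L = Con a # w" "R = []"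
    | a w where "L = []" "R = Con a # w" | s t w1 w2 where "L = s # w1" "R = t # w2"
    by (metis neq_Nil_conv sym.exhaust)
  then show ?thesis
  proof cases
    case (6 s t w1 w2)
    have V: "Var x \<in> {s, t} \<Longrightarrow> x \<in> V" for x
      using assms(2) E 6 by (auto simp: word_equation_iff)
    show ?thesis
    proof (cases "s = t \<or> hom_ext h [s] = [] \<or> hom_ext h [t] = []")
      case True
      then show ?thesis
        using pop erase_left erase_right 6 by (auto split: sym.splits)
    next
      case False
      have st: "hom_ext h [s] @ hom_ext h w1 = hom_ext h [t] @ hom_ext h w2"
        using eq 6 by simp
      show ?thesis
      proof (cases s)
        case s: (Con a)
        \<comment> \<open>Two constant heads would be equal by \<open>st\<close>, which
          \<open>False\<close> excludes.\<close>
        obtain y where t: "t = Var y" using False s st by (cases t) auto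
        obtain u where u: "h y = hom_ext h [s] @ u"
          using False s t st by (cases "h y") auto
        have n: "nielsen E (P2 y) (subst [s, Var y] y w1, Var y # subst [s, Var y] y w2)"
          using nielsen.P2[of a w1 y w2] s t 6 E by simp
        show ?thesis
          by (rule cut[OF _ u _ _ n, of w1 w2])
            (use s t 6 E V[of y] assms(3) in \<open>auto simp: holds_DEC_form\<close>)
      next
        case s: (Var x)
        show ?thesis
        proof (cases t)
          case t: (Con b)
          obtain u where u: "h x = hom_ext h [t] @ u"
            using False s t st by (cases "h x") auto
          have n: "nielsen E (P3 x) (Var x # subst [t, Var x] x w1, subst [t, Var x] x w2)"
            using nielsen.P3[of x w1 b w2] s t 6 E by simp
          show ?thesis
            by (rule cut[OF _ u _ _ n, of w2 w1])
              (use s t 6 E V[of x] assms(3) in \<open>auto simp: holds_DEC_form\<close>)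
        next
          case t: (Var y)
          have "x \<noteq> y" using False s t by simp
          \<comment> \<open>Two prefixes of the same word are comparable; the longer image decides
            which P4 case applies, and either does if they coincide.\<close>
          from st consider u where "h x = hom_ext h [t] @ u" | u where "h y = hom_ext h [s] @ u"
            using s t by (simp add: append_eq_append_conv2) metis
          then show ?thesis
          proof cases
            case u: 1
            have n: "nielsen E (P4_ge x y) (Var x # subst [t, Var x] x w1, subst [t, Var x] x w2)"
              using nielsen.P4_ge[OF \<open>x \<noteq> y\<close>, of w1 w2] s t 6 E by simp
            show ?thesis
              by (rule cut[OF _ u _ _ n, of w2 w1])
                (use s t 6 E V[of x] V[of y] assms(3) False in \<open>auto simp: holds_SUB_form\<close>)
          next
            case u: 2
            have n: "nielsen E (P4_le x y) (subst [s, Var y] y w1, Var y # subst [s, Var y] y w2)"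
              using nielsen.P4_le[OF \<open>x \<noteq> y\<close>, of w1 w2] s t 6 E by simp
            show ?thesis
              by (rule cut[OF _ u _ _ n, of w1 w2])
                (use s t 6 E V[of x] V[of y] assms(3) False in \<open>auto simp: holds_SUB_form\<close>)
          qed
        qed
      qed
    qed
  qed (use eq E assms(4) erase_left erase_right in auto)
qed

section \<open>Runs of the counter system\<close>

lemma cs_step_weq_counter_system_iff:
  "cs_step (weq_counter_system V E0) (E, v) (E', v') \<longleftrightarrow>
     nielsen_step\<^sup>*\<^sup>* E0 E \<and> v \<in> V \<rightarrow>\<^sub>E UNIV \<and> v' \<in> V \<rightarrow>\<^sub>E UNIV \<and>
     (\<exists>r. nielsen E r E' \<and> holds (rule_formula V r) v v')"
proof -
  have "nielsen_step\<^sup>*\<^sup>* E0 E'" if "nielsen_step\<^sup>*\<^sup>* E0 E" "nielsen E r E'" for r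
    using that by (meson nielsen_step_def rtranclp.rtrancl_into_rtrancl)
  then show ?thesis
    unfolding cs_step_def configurations_def weq_counter_system_def
    by (simp del: split_paired_All split_paired_Ex) blast
qed

lemma nielsen_reachable_word_equation:
  assumes "nielsen_step\<^sup>*\<^sup>* E0 E" "word_equation A V E0"
  shows "word_equation A V E"
  using assms by (induction rule: rtranclp_induct) (auto simp: nielsen_step_def nielsen_word_equation)

text \<open>Induction on the rank of the pair of equation and solution. \<open>E0\<close> stays
  fixed because it determines the counter system, while \<open>E\<close> moves through its control
  states.\<close>

lemma solves_imp_cs_reaches:
  assumes "solves A V E h" "word_equation A V E0" "finite V" "nielsen_step\<^sup>*\<^sup>* E0 E"
  shows "\<exists>w \<in> V \<rightarrow>\<^sub>E UNIV.
    cs_reaches (weq_counter_system V E0) (E, length_vector V h) (([], []), w)"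
  using assms(1,4)
proof (induction "(E, h)" arbitrary: E h rule: wf_induct_rule[OF wf_solution_rank[of V]])
  case (1 E h)
  show ?case
  proof (cases "E = ([], [])")
    case True
    then show ?thesis
      by (intro bexI[of _ "length_vector V h"]) (auto simp: cs_reaches_def)
  next
    case False
    obtain r E' h' where step: "nielsen E r E'" "solves A V E' h'"
        "holds (rule_formula V r) (length_vector V h) (length_vector V h')"
        "((E', h'), (E, h)) \<in> solution_rank V"
      using solves_push_forward[OF 1(2) nielsen_reachable_word_equation[OF 1(3) assms(2)] assms(3) False]
      by blast
    have "nielsen_step\<^sup>*\<^sup>* E0 E'"
      using 1(3) step(1) by (meson nielsen_step_def rtranclp.rtrancl_into_rtrancl)
    then obtain w where "w \<in> V \<rightarrow>\<^sub>E UNIV"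
        "cs_reaches (weq_counter_system V E0) (E', length_vector V h') (([], []), w)"
      using 1(1)[OF step(4,2)] by blast
    moreover have "cs_step (weq_counter_system V E0) (E, length_vector V h) (E', length_vector V h')"
      using 1(3) step by (auto simp: cs_step_weq_counter_system_iff)
    ultimately show ?thesis
      unfolding cs_reaches_def by (meson converse_rtranclp_into_rtranclp)
  qed
qed

text \<open>Induction from the end of the run, pulling a solution back through each
  transition.\<close>

lemma cs_reaches_imp_solves:
  assumes "cs_reaches (weq_counter_system V E0) (E, v) (([], []), w)"
    and "word_equation A V E0" "finite V" "A \<noteq> {}" "w \<in> V \<rightarrow>\<^sub>E UNIV"
  shows "\<exists>h. solves A V E h \<and> v = length_vector V h"
  using assms(1) unfolding cs_reaches_def
proof (induction rule: converse_rtranclp_induct2)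
  case refl
  \<comment> \<open>Every assignment solves the empty equation, but the final counter values must be
    lengths of actual words; repeating one letter realizes any vector.\<close>
  obtain a where "a \<in> A" using assms(4) by blast
  then show ?case
    using assms(5)
    by (intro exI[of _ "\<lambda>x. replicate (w x) a"]) (auto simp: solves_def intro!: eq_length_vectorI)
next
  case (step E v E' v')
  then obtain r h' where "nielsen E r E'" "holds (rule_formula V r) v v'" "v \<in> V \<rightarrow>\<^sub>E UNIV"
      "nielsen_step\<^sup>*\<^sup>* E0 E" "solves A V E' h'" "v' = length_vector V h'"
    by (auto simp: cs_step_weq_counter_system_iff)
  then show ?case
    using nielsen_reachable_word_equation[OF _ assms(2)] assms(3) by (blast intro: solves_pull_back)
qed

theorem theorem2:
  fixes A :: "'a set" and V :: "'v set" and E :: "('a, 'v) weq" and v :: "'v \<Rightarrow> nat"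
  assumes "finite A" and "A \<noteq> {}" and "finite V"
    and "word_equation A V E" and "quadratic E"
    and "v \<in> V \<rightarrow>\<^sub>E UNIV"
  shows "v \<in> length_abstraction A V E \<longleftrightarrow>
    (\<exists>w \<in> V \<rightarrow>\<^sub>E UNIV. cs_reaches (weq_counter_system V E) (E, v) (([], []), w))"
  unfolding length_abstraction_eq[OF assms(4)]
  using solves_imp_cs_reaches[OF _ assms(4,3)] cs_reaches_imp_solves[OF _ assms(4,3,2)]
  by blast

end
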